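(* Let $\omega\in(0,1/2)$ and, for $\delta\in(0,\pi]$, let $\lambda_\delta(n)=\frac{4}{\delta^2}\left(1-e^{-(n\delta)^2/4}\right)$ be the eigenvalues of the nonlocal operator with Gauss-type kernel; let $\lambda_0(n)=n^2$. For $\delta\in[0,\pi]$ let $$F(N;\delta,\omega)=\sum_{m=1}^\infty\frac{1}{\lambda_\delta(mN)}\left(\frac{\sin(m\pi\omega)}{m}\right)^2,\qquad \Delta_NF(N;\delta,\omega)=F(N+1;\delta,\omega)-F(N;\delta,\omega),$$ and for $\gamma>0$ let $N^*(\gamma,\delta)$ be the largest minimizer over $N\in\mathbb{Z}^+$ of $2N+\frac{2\gamma}{\pi}F(N;\delta,\omega)$. Then the nonlocal factor $\delta$ both instantly and cumulatively demotes the bubble splitting.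
   Context: Write $N^*=N^*(\gamma,\delta)$. "$\delta$ instantly demotes the bubble splitting" means: for all $\gamma>0$ and all $\delta\in(0,\pi]$, $\frac{\partial}{\partial\delta}\Delta_NF(N;\delta,\omega)\ge0$ at $N=N^*-1$ and $N=N^*$ (the condition at $N^*-1$ being void if $N^*=1$), namely $N^*(\gamma,\delta)$ is nonincreasing in $\delta$. "$\delta$ cumulatively demotes the bubble splitting" means: for all $\gamma>0$ and all $\delta\in(0,\pi]$, $\Delta_NF(N;\delta,\omega)-\Delta_NF(N;0,\omega)\ge0$ at $N=N^*-1$ and $N=N^*$ (same convention if $N^*=1$), namely $N^*(\gamma,\delta)\le N^*(\gamma,0)$. The value $\delta=0$ corresponds to the local limit $-\Delta$ with eigenvalues $n^2$. *)

theory Defs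
  imports "HOL-Analysis.Analysis"
begin

text \<open>Eigenvalues of the nonlocal operator with Gauss-type kernel; \<open>\<delta> = 0\<close> is the local limit.\<close>

definition eigval :: "real \<Rightarrow> nat \<Rightarrow> real" where
  "eigval \<delta> n = (if \<delta> = 0 then (real n)\<^sup>2
                 else 4 / \<delta>\<^sup>2 * (1 - exp (- (real n * \<delta>)\<^sup>2 / 4)))"

text \<open>The summation index is shifted: \<open>Suc m\<close> ranges over the positive integers.\<close>

definition F_term :: "nat \<Rightarrow> real \<Rightarrow> real \<Rightarrow> nat \<Rightarrow> real" where
  "F_term N \<delta> \<omega> m = 1 / eigval \<delta> (m * N) * (sin (real m * pi * \<omega>) / real m)\<^sup>2"

definition F :: "nat \<Rightarrow> real \<Rightarrow> real \<Rightarrow> real" where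
  "F N \<delta> \<omega> = (\<Sum>m. F_term N \<delta> \<omega> (Suc m))"

definition Delta_F :: "nat \<Rightarrow> real \<Rightarrow> real \<Rightarrow> real" where
  "Delta_F N \<delta> \<omega> = F (N + 1) \<delta> \<omega> - F N \<delta> \<omega>"

definition energy :: "real \<Rightarrow> real \<Rightarrow> real \<Rightarrow> nat \<Rightarrow> real" where
  "energy \<gamma> \<delta> \<omega> N = 2 * real N + 2 * \<gamma> / pi * F N \<delta> \<omega>"

definition Nstar :: "real \<Rightarrow> real \<Rightarrow> real \<Rightarrow> nat" where
  "Nstar \<omega> \<gamma> \<delta> = (GREATEST N. is_arg_min (energy \<gamma> \<delta> \<omega>) (\<lambda>N. 1 \<le> N) N)"

text \<open>
  The guard \<open>1 \<le> N\<close> makes the condition at \<open>N = N\<^sup>* - 1\<close> void when \<open>N\<^sup>* = 1\<close>.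
  Each notion comprises both the condition on \<open>\<Delta>\<^sub>N F\<close> and the resulting statement about \<open>N\<^sup>*\<close>.
\<close>

definition instantly_demotes :: "real \<Rightarrow> bool" where
  "instantly_demotes \<omega> \<longleftrightarrow>
     (\<forall>\<gamma>>0.
        (\<forall>\<delta>\<in>{0<..pi}. \<forall>N\<in>{Nstar \<omega> \<gamma> \<delta> - 1, Nstar \<omega> \<gamma> \<delta>}. 1 \<le> N \<longrightarrow>
           (\<exists>D. ((\<lambda>d. Delta_F N d \<omega>) has_real_derivative D) (at \<delta>) \<and> D \<ge> 0)) \<and>
        antimono_on {0<..pi} (Nstar \<omega> \<gamma>))"

definition cumulatively_demotes :: "real \<Rightarrow> bool" where
  "cumulatively_demotes \<omega> \<longleftrightarrow>
     (\<forall>\<gamma>>0. \<forall>\<delta>\<in>{0<..pi}.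
        (\<forall>N\<in>{Nstar \<omega> \<gamma> \<delta> - 1, Nstar \<omega> \<gamma> \<delta>}. 1 \<le> N \<longrightarrow>
           Delta_F N \<delta> \<omega> - Delta_F N 0 \<omega> \<ge> 0) \<and>
        Nstar \<omega> \<gamma> \<delta> \<le> Nstar \<omega> \<gamma> 0)"

lemma eigval_ge:
  assumes "1 \<le> n" shows "0 < eigval \<delta> 1" "eigval \<delta> 1 \<le> eigval \<delta> n"
proof -
  show "0 < eigval \<delta> 1"
    by (auto simp: eigval_def)
  have "\<delta>\<^sup>2 \<le> (real n * \<delta>)\<^sup>2"
    using assms mult_right_mono[of 1 "(real n)\<^sup>2" "\<delta>\<^sup>2"] by (simp add: power_mult_distrib)
  then show "eigval \<delta> 1 \<le> eigval \<delta> n"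
    using assms by (auto simp: eigval_def intro!: mult_left_mono divide_right_mono)
qed

lemma F_term_bounds:
  assumes "1 \<le> N"
  shows "0 \<le> F_term N \<delta> \<omega> (Suc m)"
    and "F_term N \<delta> \<omega> (Suc m) \<le> 1 / eigval \<delta> 1 * (1 / (real (Suc m))\<^sup>2)"
proof -
  have 1: "1 \<le> Suc m * N" using assms by simp
  note e = eigval_ge[OF 1, of \<delta>]
  show "0 \<le> F_term N \<delta> \<omega> (Suc m)"
    unfolding F_term_def using e by (intro mult_nonneg_nonneg) auto
  have s: "(sin (real (Suc m) * pi * \<omega>))\<^sup>2 \<le> 1"
    by (simp add: abs_square_le_1)
  have "(sin (real (Suc m) * pi * \<omega>) / real (Suc m))\<^sup>2 \<le> 1 / (real (Suc m))\<^sup>2"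
    unfolding power_divide by (intro divide_right_mono s) auto
  then show "F_term N \<delta> \<omega> (Suc m) \<le> 1 / eigval \<delta> 1 * (1 / (real (Suc m))\<^sup>2)"
    unfolding F_term_def using e
    by (intro mult_mono frac_le) auto
qed

lemma summable_F_term:
  assumes "1 \<le> N" shows "summable (\<lambda>m. F_term N \<delta> \<omega> (Suc m))"
proof (rule summable_comparison_test')
  show "summable (\<lambda>m. 1 / eigval \<delta> 1 * (1 / (real (Suc m))\<^sup>2))"
    using inverse_power_summable[of 2, where 'a = real]
    by (intro summable_mult) (subst summable_Suc_iff, simp add: inverse_eq_divide)
  show "norm (F_term N \<delta> \<omega> (Suc m)) \<le> 1 / eigval \<delta> 1 * (1 / (real (Suc m))\<^sup>2)" if "m \<ge> 0" for m
    using F_term_bounds[OF assms, of \<delta> \<omega> m] by simp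
qed

text \<open>\<open>Nstar\<close> is well defined: a largest minimizer exists.\<close>

lemma Nstar_is_largest_minimizer:
  assumes "\<gamma> > 0"
  shows "is_arg_min (energy \<gamma> \<delta> \<omega>) (\<lambda>N. 1 \<le> N) (Nstar \<omega> \<gamma> \<delta>)"
    and "\<And>N. is_arg_min (energy \<gamma> \<delta> \<omega>) (\<lambda>N. 1 \<le> N) N \<Longrightarrow> N \<le> Nstar \<omega> \<gamma> \<delta>"
proof -
  let ?E = "energy \<gamma> \<delta> \<omega>" and ?P = "is_arg_min (energy \<gamma> \<delta> \<omega>) (\<lambda>N. 1 \<le> N)"
  define B where "B = nat \<lceil>?E 1\<rceil>"
  have lb: "2 * real N \<le> ?E N" if "1 \<le> N" for N
  proof -
    have "0 \<le> F N \<delta> \<omega>"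
      unfolding F_def using F_term_bounds(1)[OF that] summable_F_term[OF that]
      by (intro suminf_nonneg) auto
    then show ?thesis using assms by (simp add: energy_def)
  qed
  have le_B: "N \<le> B" if "1 \<le> N" "?E N \<le> ?E 1" for N
    using lb[OF that(1)] that unfolding B_def by linarith
  have bdd: "N \<le> B" if "?P N" for N
    using that le_B[of N] by (auto simp: is_arg_min_linorder)
  have "1 \<le> B" using le_B[of 1] by simp
  then obtain K where K: "K \<in> {1..B}" "\<forall>M\<in>{1..B}. ?E K \<le> ?E M"
    using ex_is_arg_min_if_finite[of "{1..B}" ?E] by (auto simp: is_arg_min_linorder)
  have "?E K \<le> ?E M" if "1 \<le> M" for M
  proof (cases "M \<le> B")
    case False
    then have "?E 1 < ?E M" using le_B[OF that] by linarith
    moreover have "?E K \<le> ?E 1" using K(2) \<open>1 \<le> B\<close> by simp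
    ultimately show ?thesis by linarith
  qed (use K that in auto)
  then have "?P K" using K by (auto simp: is_arg_min_linorder)
  then show "?P (Nstar \<omega> \<gamma> \<delta>)" unfolding Nstar_def by (rule GreatestI_nat) (rule bdd)
  show "N \<le> Nstar \<omega> \<gamma> \<delta>" if "?P N" for N
    using that unfolding Nstar_def by (rule Greatest_le_nat) (rule bdd)
qed

end

theory Submission
  imports Defs
begin

text \<open>
  The increments \<open>\<Delta>\<^sub>N F\<close> are nondecreasing in \<open>\<delta> \<ge> 0\<close> for every \<open>N \<ge> 1\<close>, and already termwise
  so, because of two properties of one convex function. With \<open>t = (n \<delta>)\<^sup>2 / 4\<close> the reciprocal
  eigenvalue is \<open>1 / \<lambda>\<^sub>\<delta>(n) = n\<^sup>-\<^sup>2 \<phi>(t)\<close>, where \<open>\<phi>(t) = t / (1 - exp (- t))\<close> is convex on the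
  half-line and \<open>\<phi>(0+) = 1\<close>.

  For \<open>\<delta> > 0\<close> the chain rule cancels the factor \<open>n\<^sup>-\<^sup>2\<close> and gives
  \<open>\<partial>(1 / \<lambda>\<^sub>\<delta>(n)) / \<partial>\<delta> = \<delta>/2 \<phi>'((n \<delta>)\<^sup>2 / 4)\<close>. As \<open>\<phi>'\<close> increases (\<open>gauss_slope_mono\<close>), this is
  nondecreasing in \<open>n\<close>. As \<open>0 \<le> \<phi>' \<le> 1\<close>, the series may be differentiated term by term
  (\<open>F_has_derivative\<close>), so \<open>\<partial>\<Delta>\<^sub>N F / \<partial>\<delta> \<ge> 0\<close>. For the comparison with the local limit,
  \<open>1 / \<lambda>\<^sub>\<delta>(n) - 1 / n\<^sup>2 = \<delta>\<^sup>2/4 (\<phi>(t) - 1) / t\<close>, and the difference quotient \<open>(\<phi>(t) - 1) / t\<close> of a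
  convex function increases as well (\<open>gauss_gap_mono\<close>).

  The statements about \<open>N\<^sup>*\<close> follow by monotone comparative statics: the energy has increasing
  differences in \<open>(N, \<delta>)\<close>, so its largest minimizer cannot increase with \<open>\<delta>\<close>
  (\<open>Nstar_le_if_Delta_F_le\<close>).
\<close>

section \<open>Convexity of \<open>t / (1 - exp (- t))\<close>\<close>

text \<open>This is the derivative of \<open>\<phi>(t) = t / (1 - exp (- t))\<close>.\<close>

definition gauss_slope :: "real \<Rightarrow> real" where
  "gauss_slope t = (1 - (1 + t) * exp (- t)) / (1 - exp (- t))\<^sup>2"

text \<open>This is the difference quotient \<open>(\<phi>(t) - 1) / t\<close>.\<close>

definition gauss_gap :: "real \<Rightarrow> real" where
  "gauss_gap t = 1 / (1 - exp (- t)) - 1 / t"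

lemma one_plus_mult_exp_minus_le: "(1 + t) * exp (- t) \<le> (1 :: real)"
  using mult_right_mono[OF exp_ge_add_one_self[of t], of "exp (- t)"]
  by (simp flip: exp_add)

lemma gauss_slope_bounds:
  assumes "0 < t" shows "0 \<le> gauss_slope t" "gauss_slope t \<le> 1"
proof -
  show "0 \<le> gauss_slope t"
    using one_plus_mult_exp_minus_le[of t] by (simp add: gauss_slope_def)
  have "0 \<le> exp (- t) * (exp (- t) - (1 - t))"
    using exp_ge_add_one_self[of "- t"] by simp
  then have "1 - (1 + t) * exp (- t) \<le> (1 - exp (- t))\<^sup>2"
    by (simp add: algebra_simps power2_eq_square)
  moreover have "0 < (1 - exp (- t))\<^sup>2" using assms by simp
  ultimately show "gauss_slope t \<le> 1"
    by (simp add: gauss_slope_def)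
qed

text \<open>
  Up to a positive factor, the left-hand side is the second derivative of \<open>\<phi>\<close>. It vanishes at
  \<open>0\<close> and has derivative \<open>1 - (1 + t) exp (- t) \<ge> 0\<close>.
\<close>

lemma gauss_convexity_numerator_nonneg:
  fixes t :: real
  assumes "0 \<le> t" shows "0 \<le> t - 2 + (t + 2) * exp (- t)"
proof -
  let ?p = "\<lambda>t::real. t - 2 + (t + 2) * exp (- t)"
  have "?p 0 \<le> ?p t"
  proof (rule DERIV_nonneg_imp_nondecreasing[OF assms])
    fix x :: real
    have "(?p has_real_derivative 1 - (1 + x) * exp (- x)) (at x)"
      by (auto intro!: derivative_eq_intros simp: algebra_simps)
    with one_plus_mult_exp_minus_le[of x]
    show "\<exists>y. (?p has_real_derivative y) (at x) \<and> 0 \<le> y" by force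
  qed
  then show ?thesis by simp
qed

lemma gauss_slope_mono:
  assumes "0 < a" "a \<le> b" shows "gauss_slope a \<le> gauss_slope b"
proof (rule DERIV_nonneg_imp_nondecreasing[OF assms(2)])
  fix x assume "a \<le> x" "x \<le> b"
  then have x: "0 < x" using assms by simp
  define q where "q = exp (- x)"
  have q: "0 < q" "q < 1" using x by (auto simp: q_def)
  have num: "((\<lambda>t. 1 - (1 + t) * exp (- t)) has_real_derivative x * q) (at x)"
    unfolding q_def by (auto intro!: derivative_eq_intros simp: algebra_simps)
  have den: "((\<lambda>t. (1 - exp (- t))\<^sup>2) has_real_derivative 2 * (1 - q) * q) (at x)"
    unfolding q_def by (auto intro!: derivative_eq_intros)
  have "(gauss_slope has_real_derivative
      (x * q * (1 - q)\<^sup>2 - (1 - (1 + x) * q) * (2 * (1 - q) * q)) / ((1 - q)\<^sup>2 * (1 - q)\<^sup>2))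
      (at x)"
    unfolding gauss_slope_def[abs_def] using DERIV_divide[OF num den] q by (simp add: q_def)
  also have "(x * q * (1 - q)\<^sup>2 - (1 - (1 + x) * q) * (2 * (1 - q) * q)) / ((1 - q)\<^sup>2 * (1 - q)\<^sup>2)
      = (1 - q) * q * (x - 2 + (x + 2) * q) / ((1 - q)\<^sup>2)\<^sup>2"
    by (rule arg_cong2[where f = "(/)"]) (simp_all add: algebra_simps power2_eq_square)
  finally have "(gauss_slope has_real_derivative
      (1 - q) * q * (x - 2 + (x + 2) * q) / ((1 - q)\<^sup>2)\<^sup>2) (at x)" .
  moreover have "0 \<le> (1 - q) * q * (x - 2 + (x + 2) * q) / ((1 - q)\<^sup>2)\<^sup>2"
    using gauss_convexity_numerator_nonneg[of x] x q
    by (intro divide_nonneg_nonneg mult_nonneg_nonneg) (auto simp: q_def)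
  ultimately show "\<exists>y. (gauss_slope has_real_derivative y) (at x) \<and> 0 \<le> y" by blast
qed

text \<open>
  This is \<open>x / 2 \<le> sinh (x / 2)\<close>, written with decaying exponentials. Its square is the sign
  condition on the derivative of \<open>gauss_gap\<close>.
\<close>

lemma mult_exp_half_le:
  fixes x :: real
  assumes "0 \<le> x" shows "x * exp (- x / 2) \<le> 1 - exp (- x)"
proof -
  let ?r = "\<lambda>x::real. 1 - exp (- x) - x * exp (- x / 2)"
  have "?r 0 \<le> ?r x"
  proof (rule DERIV_nonneg_imp_nondecreasing[OF assms])
    fix y :: real
    have e: "exp (- y) = exp (- y / 2) * exp (- y / 2)" by (simp flip: exp_add)
    have "(?r has_real_derivative exp (- y / 2) * (exp (- y / 2) - (1 + - y / 2))) (at y)"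
      by (auto intro!: derivative_eq_intros simp: algebra_simps e)
    moreover have "0 \<le> exp (- y / 2) * (exp (- y / 2) - (1 + - y / 2))"
      using exp_ge_add_one_self[of "- y / 2"] by (intro mult_nonneg_nonneg) auto
    ultimately show "\<exists>z. (?r has_real_derivative z) (at y) \<and> 0 \<le> z" by blast
  qed
  then show ?thesis by simp
qed

lemma gauss_gap_mono:
  assumes "0 < a" "a \<le> b" shows "gauss_gap a \<le> gauss_gap b"
proof (rule DERIV_nonneg_imp_nondecreasing[OF assms(2)])
  fix x assume "a \<le> x" "x \<le> b"
  then have x: "0 < x" using assms by simp
  have "(gauss_gap has_real_derivative 1 / x\<^sup>2 - exp (- x) / (1 - exp (- x))\<^sup>2) (at x)"
    unfolding gauss_gap_def[abs_def] using x
    by (auto intro!: derivative_eq_intros simp: power2_eq_square)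
  moreover have "0 \<le> 1 / x\<^sup>2 - exp (- x) / (1 - exp (- x))\<^sup>2"
  proof -
    have "x\<^sup>2 * exp (- x) = (x * exp (- x / 2))\<^sup>2"
      by (simp add: power_mult_distrib flip: exp_double)
    also have "\<dots> \<le> (1 - exp (- x))\<^sup>2"
      using mult_exp_half_le[of x] x by (intro power_mono) auto
    finally show ?thesis using x by (simp add: field_simps)
  qed
  ultimately show "\<exists>y. (gauss_gap has_real_derivative y) (at x) \<and> 0 \<le> y" by blast
qed

section \<open>Dependence of the series on the nonlocal parameter\<close>

lemma inverse_eigval_eq:
  "\<delta> \<noteq> 0 \<Longrightarrow> 1 / eigval \<delta> n = \<delta>\<^sup>2 / 4 / (1 - exp (- ((real n * \<delta>)\<^sup>2 / 4)))"
  by (simp add: eigval_def)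

lemma inverse_eigval_has_derivative:
  assumes "0 < \<delta>" "1 \<le> n"
  shows "((\<lambda>d. 1 / eigval d n) has_real_derivative
          \<delta> / 2 * gauss_slope ((real n * \<delta>)\<^sup>2 / 4)) (at \<delta>)"
proof (rule has_field_derivative_transform_within_open[where S = "{0<..}"])
  define q where "q = exp (- ((real n * \<delta>)\<^sup>2 / 4))"
  have q: "q < 1" using assms by (simp add: q_def)
  have num: "((\<lambda>d. d\<^sup>2 / 4) has_real_derivative \<delta> / 2) (at \<delta>)"
    by (auto intro!: derivative_eq_intros)
  have den: "((\<lambda>d. 1 - exp (- ((real n * d)\<^sup>2 / 4))) has_real_derivative
      q * ((real n)\<^sup>2 * \<delta> / 2)) (at \<delta>)"
    unfolding q_def by (auto intro!: derivative_eq_intros simp: power2_eq_square)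
  have "((\<lambda>d. d\<^sup>2 / 4 / (1 - exp (- ((real n * d)\<^sup>2 / 4)))) has_real_derivative
      (\<delta> / 2 * (1 - q) - \<delta>\<^sup>2 / 4 * (q * ((real n)\<^sup>2 * \<delta> / 2))) / (1 - q)\<^sup>2) (at \<delta>)"
    using DERIV_divide[OF num den] q by (simp add: q_def power2_eq_square[of "1 - _"])
  also have "(\<delta> / 2 * (1 - q) - \<delta>\<^sup>2 / 4 * (q * ((real n)\<^sup>2 * \<delta> / 2))) / (1 - q)\<^sup>2
      = \<delta> / 2 * gauss_slope ((real n * \<delta>)\<^sup>2 / 4)"
    unfolding gauss_slope_def q_def[symmetric] times_divide_eq_right
    by (rule arg_cong2[where f = "(/)"]) (simp_all add: field_simps power2_eq_square)
  finally show "((\<lambda>d. d\<^sup>2 / 4 / (1 - exp (- ((real n * d)\<^sup>2 / 4)))) has_real_derivative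
      \<delta> / 2 * gauss_slope ((real n * \<delta>)\<^sup>2 / 4)) (at \<delta>)" .
qed (use assms in \<open>auto simp: inverse_eigval_eq\<close>)

definition F_term_deriv :: "nat \<Rightarrow> real \<Rightarrow> real \<Rightarrow> nat \<Rightarrow> real" where
  "F_term_deriv N \<delta> \<omega> m =
     \<delta> / 2 * gauss_slope ((real (m * N) * \<delta>)\<^sup>2 / 4) * (sin (real m * pi * \<omega>) / real m)\<^sup>2"

lemma F_term_has_derivative:
  assumes "0 < \<delta>" "1 \<le> N"
  shows "((\<lambda>d. F_term N d \<omega> (Suc m)) has_real_derivative F_term_deriv N \<delta> \<omega> (Suc m)) (at \<delta>)"
  unfolding F_term_def F_term_deriv_def
  by (rule DERIV_cmult_right[OF inverse_eigval_has_derivative]) (use assms in auto)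

lemma abs_F_term_deriv_le:
  assumes "0 < \<delta>" "\<delta> \<le> c" "1 \<le> N"
  shows "\<bar>F_term_deriv N \<delta> \<omega> (Suc m)\<bar> \<le> c / 2 * (1 / (real (Suc m))\<^sup>2)"
proof -
  have "0 < real (Suc m * N) * \<delta>"
      using assms by (intro mult_pos_pos) (simp_all del: mult_Suc of_nat_mult)
  then have "0 < (real (Suc m * N) * \<delta>)\<^sup>2 / 4"
    by (intro divide_pos_pos zero_less_power) simp_all
  note g = gauss_slope_bounds[OF this]
  have "\<delta> / 2 * gauss_slope ((real (Suc m * N) * \<delta>)\<^sup>2 / 4) \<le> c / 2 * 1"
    using assms g by (intro mult_mono) auto
  moreover have "(sin (real (Suc m) * pi * \<omega>) / real (Suc m))\<^sup>2 \<le> 1 / (real (Suc m))\<^sup>2"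
    unfolding power_divide by (intro divide_right_mono) (auto simp: abs_square_le_1)
  ultimately have "F_term_deriv N \<delta> \<omega> (Suc m) \<le> c / 2 * (1 / (real (Suc m))\<^sup>2)"
    unfolding F_term_deriv_def using assms by (intro mult_mono) auto
  moreover have "0 \<le> F_term_deriv N \<delta> \<omega> (Suc m)"
    unfolding F_term_deriv_def using assms g by (intro mult_nonneg_nonneg) auto
  ultimately show ?thesis by simp
qed

lemma summable_inverse_Suc_square: "summable (\<lambda>m. c * (1 / (real (Suc m))\<^sup>2))"
  using inverse_power_summable[of 2, where 'a = real]
  by (intro summable_mult) (subst summable_Suc_iff, simp add: inverse_eq_divide)

lemma summable_F_term_deriv:
  assumes "0 < \<delta>" "1 \<le> N" shows "summable (\<lambda>m. F_term_deriv N \<delta> \<omega> (Suc m))"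
  by (rule summable_comparison_test'[OF summable_inverse_Suc_square[of "\<delta> / 2"]])
     (simp only: real_norm_def abs_F_term_deriv_le[OF assms(1) order_refl assms(2)])

lemma F_has_derivative:
  assumes "0 < \<delta>" "1 \<le> N"
  shows "((\<lambda>d. F N d \<omega>) has_real_derivative (\<Sum>m. F_term_deriv N \<delta> \<omega> (Suc m))) (at \<delta>)"
  unfolding F_def
  \<comment> \<open>The factor \<open>\<delta> / 2\<close> in the derivatives is unbounded on the half-line, so the majorant needs an
    interval with an upper end.\<close>
proof (rule has_field_derivative_series'(2)[where S = "{0<..<\<delta> + 1}" and ?x0.0 = \<delta>])
  show "((\<lambda>d. F_term N d \<omega> (Suc m)) has_real_derivative F_term_deriv N d \<omega> (Suc m))
      (at d within {0<..<\<delta> + 1})" if "d \<in> {0<..<\<delta> + 1}" for m d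
    using that assms
    by (intro has_field_derivative_at_within[OF F_term_has_derivative]) auto
  show "uniformly_convergent_on {0<..<\<delta> + 1} (\<lambda>n d. \<Sum>m<n. F_term_deriv N d \<omega> (Suc m))"
  proof (rule Weierstrass_m_test'[OF _ summable_inverse_Suc_square[of "(\<delta> + 1) / 2"]])
    show "norm (F_term_deriv N d \<omega> (Suc m)) \<le> (\<delta> + 1) / 2 * (1 / (real (Suc m))\<^sup>2)"
      if "d \<in> {0<..<\<delta> + 1}" for m d
      unfolding real_norm_def using that assms by (intro abs_F_term_deriv_le) auto
  qed
qed (use assms summable_F_term in \<open>auto simp: interior_open\<close>)

lemma Delta_F_has_nonneg_derivative:
  assumes "0 < \<delta>" "1 \<le> N"
  shows "\<exists>D. ((\<lambda>d. Delta_F N d \<omega>) has_real_derivative D) (at \<delta>) \<and> 0 \<le> D"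
proof (intro exI conjI)
  let ?D = "\<lambda>N. \<Sum>m. F_term_deriv N \<delta> \<omega> (Suc m)"
  show "((\<lambda>d. Delta_F N d \<omega>) has_real_derivative ?D (N + 1) - ?D N) (at \<delta>)"
    unfolding Delta_F_def using assms by (intro DERIV_diff F_has_derivative) auto
  have "F_term_deriv N \<delta> \<omega> (Suc m) \<le> F_term_deriv (N + 1) \<delta> \<omega> (Suc m)" for m
  proof -
    have "0 < real (Suc m * N) * \<delta>"
      using assms by (intro mult_pos_pos) (simp_all del: mult_Suc of_nat_mult)
    moreover have "real (Suc m * N) * \<delta> \<le> real (Suc m * (N + 1)) * \<delta>"
      using assms by (intro mult_right_mono) auto
    ultimately have "gauss_slope ((real (Suc m * N) * \<delta>)\<^sup>2 / 4)
        \<le> gauss_slope ((real (Suc m * (N + 1)) * \<delta>)\<^sup>2 / 4)"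
      by (intro gauss_slope_mono divide_right_mono power_mono) auto
    then show ?thesis
      unfolding F_term_deriv_def using assms by (intro mult_right_mono mult_left_mono) auto
  qed
  then have "?D N \<le> ?D (N + 1)"
    using assms by (intro suminf_le summable_F_term_deriv) auto
  then show "0 \<le> ?D (N + 1) - ?D N" by simp
qed

lemma inverse_eigval_minus_local:
  assumes "\<delta> \<noteq> 0" "1 \<le> n"
  shows "1 / eigval \<delta> n - 1 / eigval 0 n = \<delta>\<^sup>2 / 4 * gauss_gap ((real n * \<delta>)\<^sup>2 / 4)"
proof -
  have "1 / eigval 0 n = \<delta>\<^sup>2 / 4 * (1 / ((real n * \<delta>)\<^sup>2 / 4))"
    using assms by (simp add: eigval_def power_mult_distrib)
  then show ?thesis
    by (simp add: inverse_eigval_eq[OF assms(1)] gauss_gap_def right_diff_distrib)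
qed

lemma Delta_F_local_le:
  assumes "0 < \<delta>" "1 \<le> N"
  shows "Delta_F N 0 \<omega> \<le> Delta_F N \<delta> \<omega>"
proof -
  let ?G = "\<lambda>N m. F_term N \<delta> \<omega> (Suc m) - F_term N 0 \<omega> (Suc m)"
  have diff: "summable (?G M)" "F M \<delta> \<omega> - F M 0 \<omega> = (\<Sum>m. ?G M m)" if "1 \<le> M" for M
    using summable_F_term[OF that] by (auto simp: F_def suminf_diff intro: summable_diff)
  have "?G N m \<le> ?G (N + 1) m" for m
  proof -
    have "0 < real (Suc m * N) * \<delta>"
      using assms by (intro mult_pos_pos) (simp_all del: mult_Suc of_nat_mult)
    moreover have "real (Suc m * N) * \<delta> \<le> real (Suc m * (N + 1)) * \<delta>"
      using assms by (intro mult_right_mono) auto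
    ultimately have gap: "gauss_gap ((real (Suc m * N) * \<delta>)\<^sup>2 / 4)
        \<le> gauss_gap ((real (Suc m * (N + 1)) * \<delta>)\<^sup>2 / 4)"
      by (intro gauss_gap_mono divide_right_mono power_mono) auto
    have G: "?G M m = \<delta>\<^sup>2 / 4 * gauss_gap ((real (Suc m * M) * \<delta>)\<^sup>2 / 4)
        * (sin (real (Suc m) * pi * \<omega>) / real (Suc m))\<^sup>2" if "1 \<le> M" for M
      unfolding F_term_def left_diff_distrib[symmetric]
      by (subst inverse_eigval_minus_local) (use assms that in auto)
    show ?thesis
      unfolding G[OF assms(2)] G[OF le_add2]
      by (intro mult_right_mono mult_left_mono gap) auto
  qed
  then have "(\<Sum>m. ?G N m) \<le> (\<Sum>m. ?G (N + 1) m)"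
    using assms diff(1) by (intro suminf_le) auto
  then show ?thesis
    using diff(2)[OF assms(2)] diff(2)[of "N + 1"] by (simp add: Delta_F_def)
qed

lemma Delta_F_mono:
  assumes "0 < \<delta>" "\<delta> \<le> \<delta>'" "1 \<le> N"
  shows "Delta_F N \<delta> \<omega> \<le> Delta_F N \<delta>' \<omega>"
  by (rule DERIV_nonneg_imp_nondecreasing[where f = "\<lambda>d. Delta_F N d \<omega>"])
     (use assms in \<open>auto intro: Delta_F_has_nonneg_derivative\<close>)

section \<open>Comparative statics of the largest minimizer\<close>

text \<open>
  If the largest minimizer \<open>N'\<close> at \<open>\<delta>'\<close> exceeded the one \<open>N\<close> at \<open>\<delta>\<close>, then passing from \<open>N\<close> to
  \<open>N'\<close> would not raise the energy at \<open>\<delta>'\<close>, hence not at \<open>\<delta>\<close> either, where increments are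
  smaller. So \<open>N'\<close> would minimize at \<open>\<delta>\<close>, contradicting the choice of \<open>N\<close> as the largest.
\<close>

lemma Nstar_le_if_Delta_F_le:
  assumes \<gamma>: "0 < \<gamma>" and le: "\<And>N. 1 \<le> N \<Longrightarrow> Delta_F N \<delta> \<omega> \<le> Delta_F N \<delta>' \<omega>"
  shows "Nstar \<omega> \<gamma> \<delta>' \<le> Nstar \<omega> \<gamma> \<delta>"
proof (rule ccontr)
  let ?N = "Nstar \<omega> \<gamma> \<delta>" and ?N' = "Nstar \<omega> \<gamma> \<delta>'"
  assume "\<not> ?N' \<le> ?N"
  then have less: "?N \<le> ?N'" by simp
  note min = Nstar_is_largest_minimizer(1)[OF \<gamma>, of _ \<omega>, unfolded is_arg_min_linorder]
  have N: "1 \<le> ?N" "1 \<le> ?N'" using min by auto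
  have "F ?N' \<delta> \<omega> - F ?N \<delta> \<omega> = (\<Sum>k=?N..<?N'. Delta_F k \<delta> \<omega>)"
    using sum_Suc_diff'[OF less, of "\<lambda>k. F k \<delta> \<omega>"] by (simp add: Delta_F_def)
  also have "\<dots> \<le> (\<Sum>k=?N..<?N'. Delta_F k \<delta>' \<omega>)"
    using N by (intro sum_mono le) auto
  also have "\<dots> = F ?N' \<delta>' \<omega> - F ?N \<delta>' \<omega>"
    using sum_Suc_diff'[OF less, of "\<lambda>k. F k \<delta>' \<omega>"] by (simp add: Delta_F_def)
  finally have "2 * \<gamma> / pi * (F ?N' \<delta> \<omega> - F ?N \<delta> \<omega>)
      \<le> 2 * \<gamma> / pi * (F ?N' \<delta>' \<omega> - F ?N \<delta>' \<omega>)"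
    using \<gamma> by (intro mult_left_mono) auto
  moreover have "energy \<gamma> \<delta>' \<omega> ?N' \<le> energy \<gamma> \<delta>' \<omega> ?N" using min N by blast
  ultimately have "energy \<gamma> \<delta> \<omega> ?N' \<le> energy \<gamma> \<delta> \<omega> ?N"
    unfolding energy_def right_diff_distrib by linarith
  then have "is_arg_min (energy \<gamma> \<delta> \<omega>) (\<lambda>N. 1 \<le> N) ?N'"
    unfolding is_arg_min_linorder using min N by (meson order_trans)
  from Nstar_is_largest_minimizer(2)[OF \<gamma> this] \<open>\<not> ?N' \<le> ?N\<close> show False by simp
qed

theorem corollary3p2:
  fixes \<omega> :: real
  assumes "0 < \<omega>" and "\<omega> < 1 / 2"
  shows "instantly_demotes \<omega> \<and> cumulatively_demotes \<omega>"
proof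
  show "instantly_demotes \<omega>"
    unfolding instantly_demotes_def
  proof (intro allI impI conjI ballI)
    fix \<gamma> :: real assume "0 < \<gamma>"
    then show "antimono_on {0<..pi} (Nstar \<omega> \<gamma>)"
      by (intro monotone_onI Nstar_le_if_Delta_F_le Delta_F_mono) auto
  qed (intro Delta_F_has_nonneg_derivative, simp_all)
  show "cumulatively_demotes \<omega>"
    unfolding cumulatively_demotes_def
  proof (intro allI impI conjI ballI)
    fix \<gamma> \<delta> :: real assume "0 < \<gamma>" "\<delta> \<in> {0<..pi}"
    then show "Nstar \<omega> \<gamma> \<delta> \<le> Nstar \<omega> \<gamma> 0"
      by (intro Nstar_le_if_Delta_F_le Delta_F_local_le) auto
  qed (simp add: Delta_F_local_le)
qed

end
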